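(* Let $\Psi\in\mathbb{R}^{n\times p}$ have columns $\psi_1,\dots,\psi_p$ with $\|\psi_i\|=1$ for all $i$, let $y\in\mathbb{R}^n$, let $\lambda>0$, let $\rho_{\lambda,\tau}$ be any one of the five nonconvex penalties $\ell^0$, bridge, capped-$\ell^1$, SCAD, MCP, and let $J(x)=\frac12\|\Psi x-y\|^2+\sum_{i=1}^p\rho_{\lambda,\tau}(x_i)$ for $x\in\mathbb{R}^p$. An element $x^*\in\mathbb{R}^p$ is a coordinate-wise minimizer of $J$ if and only if $$x_i^*\in S^\rho_{\lambda,\tau}(x_i^*+d_i^* )\quad\text{for } i=1,\dots,p,$$ where the dual variable $d^*$ is defined by $d^*=\Psi^t(y-\Psi x^* )$.
   Context: $\|\cdot\|$ is the Euclidean norm and $\Psi^t$ the transpose. A vector $x^*\in\mathbb{R}^p$ is a coordinate-wise minimizer of $J$ if for every $i$, $x_i^*\in\operatorname{argmin}_{t\in\mathbb{R}}J(x_1^*,\dots,x_{i-1}^*,t,x_{i+1}^*,\dots,x_p^* )$. The (possibly set-valued) thresholding operator is $S^\rho_{\lambda,\tau}(v)=\operatorname{argmin}_{u\in\mathbb{R}}\left(\frac{(u-v)^2}{2}+\rho_{\lambda,\tau}(u)\right)$, understood as the set of all minimizers. For $\lambda>0$ the five nonconvex penalties $\rho=\rho_{\lambda,\tau}:\mathbb{R}\to[0,\infty)$ are: (1) $\ell^0$: $\rho(t)=\lambda$ if $t\neq0$, $\rho(0)=0$ (no parameter $\tau$). (2) bridge, $0<\tau<1$: $\rho(t)=\lambda|t|^\tau$.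 (3) capped-$\ell^1$, $\tau>\frac12$: $\rho(t)=\lambda^2\tau$ if $|t|>\lambda\tau$, and $\rho(t)=\lambda|t|$ if $|t|\le\lambda\tau$. (4) SCAD, $\tau>2$: $\rho(t)=\frac{\lambda^2(\tau+1)}{2}$ if $|t|>\lambda\tau$; $\rho(t)=\frac{\lambda\tau|t|-\frac12(t^2+\lambda^2)}{\tau-1}$ if $\lambda<|t|\le\lambda\tau$; $\rho(t)=\lambda|t|$ if $|t|\le\lambda$. (5) MCP, $\tau>1$: $\rho(t)=\lambda\left(|t|-\frac{t^2}{2\lambda\tau}\right)$ if $|t|<\tau\lambda$, and $\rho(t)=\frac{\lambda^2\tau}{2}$ if $|t|\ge\tau\lambda$. *)

theory Defs
  imports "HOL-Analysis.Analysis"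
begin

definition argmin :: "('a \<Rightarrow> real) \<Rightarrow> 'a set" where
  "argmin f = {u. is_arg_min f (\<lambda>_. True) u}"

text \<open>The five penalty families; the argument of a constructor is the parameter \<open>\<tau>\<close>,
  which the \<open>\<ell>\<^sup>0\<close> penalty does not have.\<close>

datatype penalty = L0 | Bridge real | Capped_L1 real | SCAD real | MCP real

fun admissible :: "penalty \<Rightarrow> bool" where
  "admissible L0 \<longleftrightarrow> True"
| "admissible (Bridge \<tau>) \<longleftrightarrow> 0 < \<tau> \<and> \<tau> < 1"
| "admissible (Capped_L1 \<tau>) \<longleftrightarrow> \<tau> > 1 / 2"
| "admissible (SCAD \<tau>) \<longleftrightarrow> \<tau> > 2"
| "admissible (MCP \<tau>) \<longleftrightarrow> \<tau> > 1"

text \<open>In the bridge case \<open>0 powr \<tau> = 0\<close>, so the penalty vanishes at \<open>0\<close> as it should.\<close>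

fun rho :: "penalty \<Rightarrow> real \<Rightarrow> real \<Rightarrow> real" where
  "rho L0 lam t = (if t \<noteq> 0 then lam else 0)"
| "rho (Bridge \<tau>) lam t = lam * \<bar>t\<bar> powr \<tau>"
| "rho (Capped_L1 \<tau>) lam t = (if \<bar>t\<bar> > lam * \<tau> then lam\<^sup>2 * \<tau> else lam * \<bar>t\<bar>)"
| "rho (SCAD \<tau>) lam t =
    (if \<bar>t\<bar> > lam * \<tau> then lam\<^sup>2 * (\<tau> + 1) / 2
     else if \<bar>t\<bar> > lam then (lam * \<tau> * \<bar>t\<bar> - 1 / 2 * (t\<^sup>2 + lam\<^sup>2)) / (\<tau> - 1)
     else lam * \<bar>t\<bar>)"
| "rho (MCP \<tau>) lam t =
    (if \<bar>t\<bar> < \<tau> * lam then lam * (\<bar>t\<bar> - t\<^sup>2 / (2 * lam * \<tau>)) else lam\<^sup>2 * \<tau> / 2)"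

definition thresholding :: "penalty \<Rightarrow> real \<Rightarrow> real \<Rightarrow> real set" where
  "thresholding P lam v = argmin (\<lambda>u. (u - v)\<^sup>2 / 2 + rho P lam u)"

definition objective ::
  "real ^ 'p ^ 'n \<Rightarrow> real ^ 'n \<Rightarrow> penalty \<Rightarrow> real \<Rightarrow> real ^ 'p \<Rightarrow> real" where
  "objective \<Psi> y P lam x = 1 / 2 * (norm (\<Psi> *v x - y))\<^sup>2 + (\<Sum>i\<in>UNIV. rho P lam (x $ i))"

definition coordinatewise_minimizer :: "(real ^ 'p \<Rightarrow> real) \<Rightarrow> real ^ 'p \<Rightarrow> bool" where
  "coordinatewise_minimizer J x \<longleftrightarrow>
    (\<forall>i. x $ i \<in> argmin (\<lambda>t. J (\<chi> j. if j = i then t else x $ j)))"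

definition dual_variable :: "real ^ 'p ^ 'n \<Rightarrow> real ^ 'n \<Rightarrow> real ^ 'p \<Rightarrow> real ^ 'p" where
  "dual_variable \<Psi> y x = transpose \<Psi> *v (y - \<Psi> *v x)"

end

theory Submission
  imports Defs
begin

text \<open>Fix all coordinates of \<open>x\<close> except the \<open>i\<close>th. Replacing \<open>x $ i\<close> by \<open>t\<close> moves the residual
  \<open>\<Psi> *v x - y\<close> along the \<open>i\<close>th column, so the data term is a quadratic polynomial in \<open>t\<close>. Its leading
  coefficient is \<open>1 / 2\<close> because the column has norm 1, and its linear part is governed by the \<open>i\<close>th
  dual coordinate. The penalty is a sum over the coordinates, so it contributes \<open>rho P lam t\<close> and
  terms free of \<open>t\<close>. Completing the square turns the restricted objective into
  \<open>(t - v)\<^sup>2 / 2 + rho P lam t\<close> with \<open>v = x $ i + dual_variable \<Psi> y x $ i\<close>, up to a constant that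
  depends on \<open>x\<close> and \<open>i\<close> but not on \<open>t\<close>
  (\<open>objective_along_coordinate\<close>). Adding a constant leaves the set of minimizers unchanged, so each
  coordinate condition is literally membership in a thresholding set.\<close>

lemma argmin_add_const: "argmin (\<lambda>u. f u + c) = argmin f"
  by (simp add: argmin_def is_arg_min_def)

lemma replace_coordinate_eq_axis:
  fixes x :: "real ^ 'p"
  shows "(\<chi> j. if j = i then t else x $ j) = x + (t - x $ i) *\<^sub>R axis i 1"
  by (simp add: vec_eq_iff axis_def)

lemma dual_variable_component:
  "dual_variable \<Psi> y x $ i = - (column i \<Psi> \<bullet> (\<Psi> *v x - y))"
  by (simp add: dual_variable_def matrix_vector_mul_component row_transpose[symmetric]
      row_def transpose_def column_def inner_diff_right)

lemma half_norm_residual_along_coordinate: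
  fixes \<Psi> :: "real ^ 'p ^ 'n" and y :: "real ^ 'n" and x :: "real ^ 'p"
  assumes "norm (column i \<Psi>) = 1"
  defines "d \<equiv> dual_variable \<Psi> y x $ i"
  shows "1 / 2 * (norm (\<Psi> *v (\<chi> j. if j = i then t else x $ j) - y))\<^sup>2 =
    (t - (x $ i + d))\<^sup>2 / 2 + (1 / 2 * (norm (\<Psi> *v x - y))\<^sup>2 - d\<^sup>2 / 2)"
proof -
  define c r s where "c = column i \<Psi>" and "r = \<Psi> *v x - y" and "s = t - x $ i"
  have "\<Psi> *v (\<chi> j. if j = i then t else x $ j) - y = r + s *\<^sub>R c"
    by (simp add: replace_coordinate_eq_axis matrix_vector_right_distrib
        matrix_vector_mult_scaleR matrix_vector_mult_basis c_def r_def s_def)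
  moreover have "c \<bullet> c = 1"
    using assms(1) by (simp add: c_def dot_square_norm)
  ultimately have "(norm (\<Psi> *v (\<chi> j. if j = i then t else x $ j) - y))\<^sup>2 =
      (norm r)\<^sup>2 + 2 * s * (c \<bullet> r) + s\<^sup>2"
    by (simp add: power2_norm_eq_inner inner_add_left inner_add_right inner_commute[of r c])
      (simp add: power2_eq_square distrib_left)
  moreover have "c \<bullet> r = - d"
    by (simp add: d_def dual_variable_component c_def r_def)
  ultimately show ?thesis
    by (simp add: r_def s_def power2_eq_square field_simps)
qed

lemma sum_replace_coordinate:
  fixes x :: "real ^ 'p" and g :: "real \<Rightarrow> real"
  shows "(\<Sum>k\<in>UNIV. g ((\<chi> j. if j = i then t else x $ j) $ k)) =
    g t + (\<Sum>k\<in>UNIV - {i}. g (x $ k))"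
proof -
  have "(\<Sum>k\<in>UNIV - {i}. g ((\<chi> j. if j = i then t else x $ j) $ k)) =
      (\<Sum>k\<in>UNIV - {i}. g (x $ k))"
    by (rule sum.cong) auto
  then show ?thesis
    by (simp add: sum.remove[of UNIV i])
qed

lemma objective_along_coordinate:
  fixes \<Psi> :: "real ^ 'p ^ 'n" and y :: "real ^ 'n" and x :: "real ^ 'p"
  assumes "norm (column i \<Psi>) = 1"
  obtains C where "\<And>t. objective \<Psi> y P lam (\<chi> j. if j = i then t else x $ j) =
    ((t - (x $ i + dual_variable \<Psi> y x $ i))\<^sup>2 / 2 + rho P lam t) + C"
proof
  fix t
  show "objective \<Psi> y P lam (\<chi> j. if j = i then t else x $ j) =
    ((t - (x $ i + dual_variable \<Psi> y x $ i))\<^sup>2 / 2 + rho P lam t) +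
    (1 / 2 * (norm (\<Psi> *v x - y))\<^sup>2 - (dual_variable \<Psi> y x $ i)\<^sup>2 / 2
      + (\<Sum>k\<in>UNIV - {i}. rho P lam (x $ k)))"
    unfolding objective_def half_norm_residual_along_coordinate[OF assms] sum_replace_coordinate
    by (simp only: ac_simps)
qed

lemma argmin_objective_along_coordinate:
  fixes \<Psi> :: "real ^ 'p ^ 'n" and y :: "real ^ 'n" and x :: "real ^ 'p"
  assumes "norm (column i \<Psi>) = 1"
  shows "argmin (\<lambda>t. objective \<Psi> y P lam (\<chi> j. if j = i then t else x $ j)) =
    thresholding P lam (x $ i + dual_variable \<Psi> y x $ i)"
proof -
  obtain C where "\<And>t. objective \<Psi> y P lam (\<chi> j. if j = i then t else x $ j) =
      ((t - (x $ i + dual_variable \<Psi> y x $ i))\<^sup>2 / 2 + rho P lam t) + C"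
    using objective_along_coordinate[OF assms] by blast
  then show ?thesis
    by (simp only: thresholding_def argmin_add_const)
qed

theorem lemma3p4:
  fixes \<Psi> :: "real ^ 'p ^ 'n" and y :: "real ^ 'n" and xs :: "real ^ 'p"
    and lam :: real and P :: penalty
  assumes "\<And>i. norm (column i \<Psi>) = 1"
    and "lam > 0"
    and "admissible P"
  shows "coordinatewise_minimizer (objective \<Psi> y P lam) xs \<longleftrightarrow>
    (\<forall>i. xs $ i \<in> thresholding P lam (xs $ i + dual_variable \<Psi> y xs $ i))"
  by (simp only: coordinatewise_minimizer_def argmin_objective_along_coordinate[OF assms(1)])

end
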